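(* Let $\mathcal{H}$ be an intersection-closed concept class on an instance space $\mathcal{X}$, with VC dimension $d_{\mathrm{VC}}(\mathcal{H})$. There is a learner that PAC-learns $\mathcal{H}$ with improvements with respect to any improvement function $\Delta$ and any data distribution $\mathcal{D}$, given a sample of size $O\left(\frac1\epsilon\left(d_{\mathrm{VC}}(\mathcal{H})+\log\frac1\delta\right)\right)$ (with a universal constant in the $O(\cdot)$).
   Context: Classifiers $h:\mathcal{X}\to\{0,1\}$ are identified with the sets $\{x:h(x)=1\}$. For $A\subseteq\mathcal{X}$, $\mathrm{CLOS}_{\mathcal{H}}(A)=\bigcap_{h\in\mathcal{H},A\subseteq h}h$, with $\mathrm{CLOS}_{\mathcal{H}}(A)=\mathcal{X}$ if no $h\in\mathcal{H}$ contains $A$. $\mathcal{H}$ is intersection-closed if $\mathrm{CLOS}_{\mathcal{H}}(A)\in\mathcal{H}$ for all finite $A\subseteq\mathcal{X}$. An improvement function is a map $\Delta:\mathcal{X}\to 2^{\mathcal{X}}$. For a classifier $h$ the reaction set of $x$ is: $\Delta_h(x)=\{x\}$ if $h(x)=1$; $\Delta_h(x)=\{x\}$ if $\{x'\in\Delta(x): h(x')=1\}=\emptyset$; and $\Delta_h(x)=\{x'\in\Delta(x):h(x')=1\}$ otherwise. For a target $f^*$, $\mathrm{Loss}(x;h,f^* )=\max_{x'\in\Delta_h(x)}\mathbb{I}[h(x')\neq f^*(x')]$ and $\mathrm{Loss}_{\mathcal{D}}(h,f^* )=\mathbb{P}_{x\sim\mathcal{D}}[\mathrm{Loss}(x;h,f^*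 )=1]$. A learner PAC-learns $\mathcal{H}$ with improvements with respect to $\Delta$ and $\mathcal{D}$ using sample size $M=M(\epsilon,\delta)$ if for any $f^*\in\mathcal{H}$ and any $\epsilon,\delta\in(0,1)$, given $M$ i.i.d. examples from $\mathcal{D}$ labeled by $f^*$, it outputs with probability at least $1-\delta$ a hypothesis $h$ with $\mathrm{Loss}_{\mathcal{D}}(h,f^* )\le\epsilon$.
   Formalization: "Any data distribution" is restricted to those for which all concepts and the relation "x lies in the closure of a finite sample" are measurable up to null sets (the claim fails for pathological distributions); d_VC is finite; the constant is stated per ambient type. *)

theory Defs
  imports "HOL-Probability.Probability"
begin

text \<open>
  The instance space is a carrier set \<open>X\<close>; a classifier \<open>h : X \<rightarrow> {0,1}\<close> is identified with
  the set \<open>{x. h x = 1}\<close>, and a concept class is a family \<open>H \<subseteq> Pow X\<close>.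
\<close>

definition clos :: "'a set \<Rightarrow> 'a set set \<Rightarrow> 'a set \<Rightarrow> 'a set" where
  "clos X H A = (if \<exists>h\<in>H. A \<subseteq> h then \<Inter>{h \<in> H. A \<subseteq> h} else X)"

definition intersection_closed :: "'a set \<Rightarrow> 'a set set \<Rightarrow> bool" where
  "intersection_closed X H \<longleftrightarrow> (\<forall>A. finite A \<and> A \<subseteq> X \<longrightarrow> clos X H A \<in> H)"

definition shatters :: "'a set set \<Rightarrow> 'a set \<Rightarrow> bool" where
  "shatters H A \<longleftrightarrow> (\<forall>B\<subseteq>A. \<exists>h\<in>H. h \<inter> A = B)"

definition vc_dim :: "'a set \<Rightarrow> 'a set set \<Rightarrow> enat" where
  "vc_dim X H = (SUP A \<in> {A. A \<subseteq> X \<and> finite A \<and> shatters H A}. enat (card A))"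

definition reaction_set :: "('a \<Rightarrow> 'a set) \<Rightarrow> 'a set \<Rightarrow> 'a \<Rightarrow> 'a set" where
  "reaction_set \<Delta> h x =
     (if x \<in> h then {x}
      else if {x' \<in> \<Delta> x. x' \<in> h} = {} then {x}
      else {x' \<in> \<Delta> x. x' \<in> h})"

text \<open>
  The maximum is well defined even if the reaction set is infinite: it is taken over a
  nonempty subset of \<open>{0, 1}\<close>.
\<close>

definition improvement_loss :: "('a \<Rightarrow> 'a set) \<Rightarrow> 'a set \<Rightarrow> 'a set \<Rightarrow> 'a \<Rightarrow> nat" where
  "improvement_loss \<Delta> h f x =
     Max ((\<lambda>x'. of_bool ((x' \<in> h) \<noteq> (x' \<in> f))) ` reaction_set \<Delta> h x)"

text \<open>
  For an arbitrary \<open>\<Delta>\<close> the set of points with loss 1 need not be measurable. The probability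
  is therefore taken as an outer probability, which agrees with the ordinary one on
  measurable sets (whereas \<open>measure D\<close> would silently be 0 on non-measurable sets).
\<close>

definition expected_improvement_loss ::
    "('a \<Rightarrow> 'a set) \<Rightarrow> 'a measure \<Rightarrow> 'a set \<Rightarrow> 'a set \<Rightarrow> ennreal" where
  "expected_improvement_loss \<Delta> D h f =
     outer_measure_of D {x \<in> space D. improvement_loss \<Delta> h f x = 1}"

definition labeled_sample :: "'a set \<Rightarrow> nat \<Rightarrow> (nat \<Rightarrow> 'a) \<Rightarrow> ('a \<times> bool) list" where
  "labeled_sample f m S = map (\<lambda>i. (S i, S i \<in> f)) [0..<m]"

text \<open>
  The learner sees only the labelled sample. Likewise, the event that the learner succeeds
  need not be measurable: ``with probability at least \<open>1 - \<delta>\<close>'' means that it contains a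
  measurable event \<open>G\<close> of that probability.
\<close>

definition PAC_learns_with_improvements ::
    "'a set set \<Rightarrow> ('a \<Rightarrow> 'a set) \<Rightarrow> 'a measure \<Rightarrow> (real \<Rightarrow> real \<Rightarrow> nat) \<Rightarrow>
     (('a \<times> bool) list \<Rightarrow> 'a set) \<Rightarrow> bool" where
  "PAC_learns_with_improvements H \<Delta> D M learner \<longleftrightarrow>
     (\<forall>f\<in>H. \<forall>\<epsilon>\<in>{0<..<1}. \<forall>\<delta>\<in>{0<..<1}.
        \<exists>G \<in> sets (Pi\<^sub>M {..<M \<epsilon> \<delta>} (\<lambda>_. D)).
          measure (Pi\<^sub>M {..<M \<epsilon> \<delta>} (\<lambda>_. D)) G \<ge> 1 - \<delta> \<and>
          (\<forall>S\<in>G. expected_improvement_loss \<Delta> D (learner (labeled_sample f (M \<epsilon> \<delta>) S)) f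
                   \<le> ennreal \<epsilon>))"

text \<open>
  The usual regularity convention of VC theory, up to null sets: the concepts are measurable,
  and so is membership of a point in the closure of a finite sample, jointly in both. It holds
  for every \<open>H\<close> if \<open>D\<close> is concentrated on a countable set all of whose subsets are measurable.
  Measurability of the concepts alone is not enough: on the first uncountable ordinal with the
  countable-cocountable probability measure, the class consisting of all countable initial
  segments and the whole space is intersection-closed of VC dimension 1, but for the whole
  space as target the closure of any sample is a null set.
\<close>

definition well_behaved :: "'a set \<Rightarrow> 'a set set \<Rightarrow> 'a measure \<Rightarrow> bool" where
  "well_behaved X H D \<longleftrightarrow>
     (\<forall>h\<in>H. h \<in> sets (completion D)) \<and>
     (\<forall>n::nat. {(S, x). S \<in> space (Pi\<^sub>M {..<n} (\<lambda>_. D)) \<and> x \<in> space D \<and> x \<in> clos X H (S ` {..<n})}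
          \<in> sets (completion (Pi\<^sub>M {..<n} (\<lambda>_. D) \<Otimes>\<^sub>M D)))"

end

theory Submission
  imports Defs
begin

text \<open>
  The learner outputs the closure of the positive examples. This set is contained in the target
  \<open>f\<close>, so an agent never improves to a false positive and the loss is at most the mass of the
  error set \<open>f - clos S\<close>.

  The \<open>k\<close>-th moment of this mass is the probability that, among \<open>m + k\<close> examples, the last \<open>k\<close>
  all lie in \<open>f\<close> but outside the closure of the positive examples among the first \<open>m\<close>. By
  exchangeability, it suffices to bound the number of \<open>k\<close>-subsets \<open>K\<close> of a fixed sample that
  are misclassified entirely by the closure of the remaining examples. Any finite set is spanned
  by at most \<open>d\<close> of its elements, because an irredundant set is shattered; pairing each \<open>K\<close>
  with a spanning set of the other positive examples, Bollobas' set pairs inequality bounds the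
  number of such \<open>K\<close> by \<open>(d + k) choose k\<close>. The \<open>k\<close>-th moment is thus at most
  \<open>((d + k) / m) ^ k\<close>, and Markov's inequality with \<open>k\<close> about \<open>ln (1 / \<delta>)\<close> gives the optimal rate.
\<close>

section \<open>Bollobas' set pairs inequality\<close>

text \<open>Induction on the ground set: average the claim for \<open>V - {x}\<close> over all \<open>x \<in> V\<close>.\<close>

lemma set_pairs_inequality:
  fixes A B :: "'i \<Rightarrow> 'v set"
  assumes "finite V" "finite I"
    and "\<And>i. i \<in> I \<Longrightarrow> A i \<subseteq> V" "\<And>i. i \<in> I \<Longrightarrow> B i \<subseteq> V"
    and "\<And>i. i \<in> I \<Longrightarrow> A i \<inter> B i = {}"
    and "\<And>i j. i \<in> I \<Longrightarrow> j \<in> I \<Longrightarrow> i \<noteq> j \<Longrightarrow> A i \<inter> B j \<noteq> {}"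
  shows "(\<Sum>i\<in>I. 1 / real ((card (A i) + card (B i)) choose card (B i))) \<le> 1"
  using assms
proof (induction "card V" arbitrary: V I A rule: less_induct)
  case less
  note fin = \<open>finite V\<close> \<open>finite I\<close> and AV = less.prems(3) and BV = less.prems(4)
    and disj = less.prems(5) and cross = less.prems(6)
  define w where "w a b = 1 / real ((a + b) choose b)" for a b :: nat
  show ?case
  proof (cases "\<exists>i\<in>I. A i = {}")
    case True
    then obtain i where i: "i \<in> I" "A i = {}" by auto
    \<comment> \<open>An empty \<open>A i\<close> meets no \<open>B j\<close>, so \<open>i\<close>
      is the only index, and its term is 1.\<close>
    with cross have "I = {i}" by blast
    then show ?thesis using i by simp
  next
    case nonempty: False
    show ?thesis
    proof (cases "V = {}")
      case True
      with nonempty AV have "I = {}" by blast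
      then show ?thesis by simp
    next
      case False
      \<comment> \<open>Only the pairs with \<open>x\<close> outside \<open>B i\<close> are kept.
        Their crossings survive the deletion of \<open>x\<close>, because a common element of
        \<open>A i\<close> and \<open>B j\<close> differs from \<open>x\<close> when
        \<open>x\<close> is not in \<open>B j\<close>.\<close>
      have IH: "(\<Sum>i\<in>{i\<in>I. x \<notin> B i}. w (card (A i - {x})) (card (B i))) \<le> 1" if "x \<in> V" for x
        unfolding w_def
      proof (rule less.hyps[of "V - {x}"])
        show "card (V - {x}) < card V" using that fin by (intro psubset_card_mono) auto
        show "A i - {x} \<subseteq> V - {x}" "B i \<subseteq> V - {x}" "(A i - {x}) \<inter> B i = {}"
          if "i \<in> {i\<in>I. x \<notin> B i}" for i
          using that AV[of i] BV[of i] disj[of i] by auto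
        show "(A i - {x}) \<inter> B j \<noteq> {}"
          if "i \<in> {i\<in>I. x \<notin> B i}" "j \<in> {i\<in>I. x \<notin> B i}" "i \<noteq> j" for i j
          using that cross[of i j] by auto
      qed (use fin in auto)
      \<comment> \<open>Let \<open>a\<close>, \<open>b\<close> be the sizes of \<open>A i\<close>,
        \<open>B i\<close>. Each of the \<open>a\<close> points of \<open>A i\<close> contributes
        \<open>w (a - 1) b\<close>, and \<open>a * w (a - 1) b = (a + b) * w a b\<close> by
        absorption. The \<open>card V - (a + b)\<close> points outside both sets contribute
        \<open>w a b\<close> each.\<close>
      have wsum: "(\<Sum>x\<in>V - B i. w (card (A i - {x})) (card (B i))) =
          real (card V) * w (card (A i)) (card (B i))" if i: "i \<in> I" for i
      proof -
        define a b where "a = card (A i)" and "b = card (B i)"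
        have finAB: "finite (A i)" "finite (B i)" using AV[OF i] BV[OF i] fin
          by (auto intro: finite_subset)
        obtain a' where a': "a = Suc a'"
          using nonempty i finAB unfolding a_def by (metis card_0_eq not0_implies_Suc)
        have "V - B i = A i \<union> (V - (A i \<union> B i))" using AV[OF i] disj[OF i] by auto
        then have "(\<Sum>x\<in>V - B i. w (card (A i - {x})) b) =
            (\<Sum>x\<in>A i. w (card (A i - {x})) b) + (\<Sum>x\<in>V - (A i \<union> B i). w (card (A i - {x})) b)"
          by (simp only:, intro sum.union_disjoint) (use fin finAB in auto)
        also have "(\<Sum>x\<in>A i. w (card (A i - {x})) b) = (\<Sum>x\<in>A i. w a' b)"
          using a' by (intro sum.cong) (auto simp: a_def)
        also have "(\<Sum>x\<in>V - (A i \<union> B i). w (card (A i - {x})) b) =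
            (\<Sum>x\<in>V - (A i \<union> B i). w a b)"
          by (intro sum.cong) (auto simp: a_def)
        also have "card (V - (A i \<union> B i)) = card V - (a + b)"
          using finAB AV[OF i] BV[OF i] disj[OF i]
          by (subst card_Diff_subset) (auto simp: card_Un_disjoint a_def b_def)
        then have "(\<Sum>x\<in>V - (A i \<union> B i). w a b) = (real (card V) - real (a + b)) * w a b"
          using card_mono[OF fin(1), of "A i \<union> B i"] finAB AV[OF i] BV[OF i] disj[OF i]
          by (simp add: card_Un_disjoint a_def b_def of_nat_diff)
        also have "(\<Sum>x\<in>A i. w a' b) = real (a + b) * w a b"
        proof -
          have "Suc a' * ((Suc a' + b) choose b) = (Suc a' + b) * ((a' + b) choose b)"
            using Suc_times_binomial_eq[of "a' + b" a'] binomial_symmetric[of b "a' + b"]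
              binomial_symmetric[of b "Suc a' + b"] by (simp add: algebra_simps)
          then have "real (Suc a') * real ((Suc a' + b) choose b) =
              real (Suc a' + b) * real ((a' + b) choose b)"
            by (metis of_nat_mult)
          moreover have "real ((a' + b) choose b) > 0" "real ((Suc a' + b) choose b) > 0"
            by simp_all
          moreover have "card (A i) = Suc a'" using a' by (simp add: a_def)
          ultimately show ?thesis
            unfolding w_def a' by (simp add: field_simps)
        qed
        finally show ?thesis by (simp add: a_def b_def algebra_simps)
      qed
      have "real (card V) * (\<Sum>i\<in>I. w (card (A i)) (card (B i))) =
          (\<Sum>i\<in>I. \<Sum>x\<in>{x\<in>V. x \<notin> B i}. w (card (A i - {x})) (card (B i)))"
        using wsum by (simp add: sum_distrib_left set_diff_eq)
      also have "\<dots> = (\<Sum>x\<in>V. \<Sum>i\<in>{i\<in>I. x \<notin> B i}. w (card (A i - {x})) (card (B i)))"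
        by (rule sum.swap_restrict[OF fin(2) fin(1)])
      also have "\<dots> \<le> (\<Sum>x\<in>V. 1)" by (intro sum_mono IH)
      finally have "real (card V) * (\<Sum>i\<in>I. w (card (A i)) (card (B i))) \<le> real (card V) * 1"
        by simp
      then show ?thesis
        using False fin unfolding w_def
        by (subst (asm) mult_le_cancel_left_pos) (auto simp: card_gt_0_iff)
    qed
  qed
qed

section \<open>Closures and spanning sets\<close>

lemma clos_subset: "h \<in> H \<Longrightarrow> A \<subseteq> h \<Longrightarrow> clos X H A \<subseteq> h"
  by (auto simp: clos_def)

lemma clos_extensive: "A \<subseteq> X \<Longrightarrow> A \<subseteq> clos X H A"
  by (auto simp: clos_def)

lemma clos_in: "intersection_closed X H \<Longrightarrow> finite A \<Longrightarrow> A \<subseteq> X \<Longrightarrow> clos X H A \<in> H"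
  by (simp add: intersection_closed_def)

lemma clos_le:
  "intersection_closed X H \<Longrightarrow> finite B \<Longrightarrow> B \<subseteq> X \<Longrightarrow> A \<subseteq> clos X H B \<Longrightarrow> clos X H A \<subseteq> clos X H B"
  by (intro clos_subset clos_in)

lemma clos_mono:
  "intersection_closed X H \<Longrightarrow> finite B \<Longrightarrow> B \<subseteq> X \<Longrightarrow> A \<subseteq> B \<Longrightarrow> clos X H A \<subseteq> clos X H B"
  using clos_extensive[of B X H] by (intro clos_le) auto

lemma card_le_vc_dim:
  assumes "vc_dim X H = enat d" "A \<subseteq> X" "finite A" "shatters H A"
  shows "card A \<le> d"
proof -
  have "enat (card A) \<le> vc_dim X H"
    unfolding vc_dim_def using assms by (intro SUP_upper) auto
  then show ?thesis using assms by simp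
qed

text \<open>Choose \<open>B\<close> of least cardinality among the subsets of \<open>A\<close> whose
  closure contains \<open>A\<close>. No \<open>b\<close> in \<open>B\<close> lies in the closure of
  \<open>B - {b}\<close>, or else \<open>b\<close> could be dropped. Hence the closure of each
  \<open>C \<subseteq> B\<close> meets \<open>B\<close> in exactly \<open>C\<close>, and these
  closures belong to \<open>H\<close>, so they shatter \<open>B\<close>.\<close>

lemma spanning_subset_exists:
  assumes ic: "intersection_closed X H" and vc: "vc_dim X H = enat d"
    and A: "finite A" "A \<subseteq> X"
  obtains B where "B \<subseteq> A" "card B \<le> d" "A \<subseteq> clos X H B"
proof -
  obtain B where B: "B \<subseteq> A" "A \<subseteq> clos X H B"
    and min: "\<And>B'. B' \<subseteq> A \<Longrightarrow> A \<subseteq> clos X H B' \<Longrightarrow> card B \<le> card B'"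
    using ex_has_least_nat[of "\<lambda>B. B \<subseteq> A \<and> A \<subseteq> clos X H B" A card]
      clos_extensive[OF A(2), of H] by auto
  have finB: "finite B" "B \<subseteq> X" using A B by (auto intro: finite_subset)
  have irred: "b \<notin> clos X H (B - {b})" if b: "b \<in> B" for b
  proof
    assume "b \<in> clos X H (B - {b})"
    moreover have "B - {b} \<subseteq> clos X H (B - {b})" using finB by (intro clos_extensive) auto
    ultimately have "B \<subseteq> clos X H (B - {b})" by auto
    then have "clos X H B \<subseteq> clos X H (B - {b})" using finB by (intro clos_le[OF ic]) auto
    with B have "card B \<le> card (B - {b})" by (intro min) auto
    with b finB show False by (meson card_Diff1_less not_le)
  qed
  have "shatters H B"
    unfolding shatters_def
  proof (intro allI impI bexI)
    fix C assume C: "C \<subseteq> B"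
    have "b \<notin> clos X H C" if "b \<in> B" "b \<notin> C" for b
      using irred[OF that(1)] clos_mono[OF ic, of "B - {b}" C] C finB that by auto
    then show "clos X H C \<inter> B = C" using C finB clos_extensive[of C X H] by auto
    show "clos X H C \<in> H" using C finB by (intro clos_in[OF ic]) (auto intro: finite_subset)
  qed
  then have "card B \<le> d" by (intro card_le_vc_dim[OF vc]) (use finB in auto)
  with B that show thesis by blast
qed

section \<open>Counting hold-out errors on a fixed sample\<close>

text \<open>The index set is a parameter so that any part of a sample can serve for training. It
  consists of positions rather than points, so repeated points do no harm.\<close>

definition error_set :: "'a set \<Rightarrow> 'a set set \<Rightarrow> 'a set \<Rightarrow> nat set \<Rightarrow> (nat \<Rightarrow> 'a) \<Rightarrow> 'a set" where
  "error_set X H f I S = f - clos X H (S ` {i\<in>I. S i \<in> f})"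

text \<open>The set pairs are \<open>B K\<close>, at most \<open>d\<close> positions spanning the
  positive examples outside \<open>K\<close>, and \<open>K\<close> itself. If \<open>B K\<close>
  avoids \<open>K'\<close>, it consists of positive training positions for \<open>K'\<close>, so
  their closure contains all positive points outside \<open>K\<close>. The points of
  \<open>K'\<close> lie in \<open>f\<close> but not in that closure; hence
  \<open>K' \<subseteq> K\<close>, and equal sizes force equality.\<close>

lemma card_holdout_error_le:
  fixes x :: "nat \<Rightarrow> 'a"
  assumes ic: "intersection_closed X H" and vc: "vc_dim X H = enat d" and fX: "f \<subseteq> X"
    and N: "finite N"
  shows "card {K. K \<subseteq> N \<and> card K = k \<and> x ` K \<subseteq> error_set X H f (N - K) x} \<le> (d + k) choose k"
proof -
  define \<K> where "\<K> = {K. K \<subseteq> N \<and> card K = k \<and> x ` K \<subseteq> error_set X H f (N - K) x}"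
  define P where "P K = {i\<in>N - K. x i \<in> f}" for K
  have PX: "x ` P K \<subseteq> X" "finite (x ` P K)" for K using fX N by (auto simp: P_def)
  have "\<exists>B. B \<subseteq> P K \<and> card B \<le> d \<and> x ` P K \<subseteq> clos X H (x ` B)" for K
  proof -
    obtain C where C: "C \<subseteq> x ` P K" "card C \<le> d" "x ` P K \<subseteq> clos X H C"
      using spanning_subset_exists[OF ic vc PX(2,1)] by blast
    \<comment> \<open>Positions on which \<open>x\<close> is injective carry the bound on
      \<open>card C\<close> over to \<open>B\<close>.\<close>
    obtain B where B: "B \<subseteq> P K" "inj_on x B" "x ` B = C"
      using C(1) by (auto simp: subset_image_inj)
    with C show ?thesis by (metis card_image)
  qed
  then obtain B where B: "\<And>K. B K \<subseteq> P K" "\<And>K. card (B K) \<le> d"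
    "\<And>K. x ` P K \<subseteq> clos X H (x ` B K)" by metis
  have finK: "finite \<K>" unfolding \<K>_def using N by auto
  have cardK: "card K = k" "K \<subseteq> N" if "K \<in> \<K>" for K using that by (auto simp: \<K>_def)
  have cross: "K' \<subseteq> K" if K: "K \<in> \<K>" "K' \<in> \<K>" and empty: "B K \<inter> K' = {}" for K K'
  proof
    fix i assume i: "i \<in> K'"
    have "B K \<subseteq> P K'" using B(1)[of K] empty by (auto simp: P_def)
    then have "clos X H (x ` B K) \<subseteq> clos X H (x ` P K')"
      using PX by (intro clos_mono[OF ic]) auto
    with B(3) have "x ` P K \<subseteq> clos X H (x ` P K')" by blast
    moreover have "x i \<in> f" "x i \<notin> clos X H (x ` P K')" "i \<in> N"
      using i K(2) by (auto simp: \<K>_def error_set_def P_def)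
    ultimately show "i \<in> K" by (auto simp: P_def)
  qed
  have "(\<Sum>K\<in>\<K>. 1 / real ((card (B K) + card K) choose card K)) \<le> 1"
  proof (rule set_pairs_inequality[where V = N])
    show "B K \<inter> K' \<noteq> {}" if "K \<in> \<K>" "K' \<in> \<K>" "K \<noteq> K'" for K K'
      using cross[OF that(1,2)] cardK that N by (metis card_subset_eq finite_subset)
    show "B K \<subseteq> N" "B K \<inter> K = {}" for K using B(1)[of K] by (auto simp: P_def)
  qed (use N finK cardK in auto)
  moreover have "(\<Sum>K\<in>\<K>. 1 / real ((d + k) choose k)) \<le>
      (\<Sum>K\<in>\<K>. 1 / real ((card (B K) + card K) choose card K))"
    using B(2) cardK by (intro sum_mono divide_left_mono of_nat_mono)
      (auto intro!: binomial_right_mono)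
  ultimately have "real (card \<K>) * (1 / real ((d + k) choose k)) \<le> 1"
    unfolding sum_constant by linarith
  moreover have "real ((d + k) choose k) > 0" by simp
  ultimately have "real (card \<K>) \<le> real ((d + k) choose k)"
    by (simp add: divide_le_eq del: binomial_eq_0_iff)
  then show ?thesis unfolding \<K>_def by simp
qed

section \<open>Completions and measure-preserving maps\<close>

text \<open>A measure-preserving map pulls null sets back to null sets, so it stays measurable
  between the completions.\<close>

lemma vimage_sets_completion:
  assumes T: "T \<in> M \<rightarrow>\<^sub>M N" and pres: "distr M N T = N" and A: "A \<in> sets (completion N)"
  shows "T -` A \<inter> space M \<in> sets (completion M)"
proof -
  have "T \<in> completion M \<rightarrow>\<^sub>M completion N"
    using measurable_completion[OF T]
    by (rule completion.measurable_completion2) (simp add: distr_completion T pres)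
  from measurable_sets[OF this A] show ?thesis by simp
qed

text \<open>Regularity is assumed only in the completion; adding a null set yields a measurable set
  to which sections and Fubini's theorem apply.\<close>

lemma completion_AE_superset:
  assumes "A \<in> sets (completion M)"
  obtains U where "U \<in> sets M" "A \<subseteq> U" "AE x in M. x \<in> U \<longrightarrow> x \<in> A"
proof -
  from assms obtain S N N' where A: "A = S \<union> N" "N \<subseteq> N'" "N' \<in> null_sets M" "S \<in> sets M"
    by (rule sets_completionE)
  have "AE x in M. x \<in> S \<union> N' \<longrightarrow> x \<in> A"
    using AE_not_in[OF A(3)] by eventually_elim (use A in auto)
  with A show thesis by (intro that[of "S \<union> N'"]) auto
qed

text \<open>Serves to pull almost-everywhere statements about a training sample with one fresh point
  back to a joint sample. The map factors through the coordinates \<open>insert i I\<close>, whose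
  product is identified with the pair by \<open>S(i := x)\<close>.\<close>

lemma distr_PiM_restrict_pair:
  assumes D: "prob_space D" and I: "I \<subseteq> J" "i \<in> J" "i \<notin> I"
  shows "distr (Pi\<^sub>M J (\<lambda>_. D)) (Pi\<^sub>M I (\<lambda>_. D) \<Otimes>\<^sub>M D) (\<lambda>\<omega>. (restrict \<omega> I, \<omega> i)) =
    Pi\<^sub>M I (\<lambda>_. D) \<Otimes>\<^sub>M D"
proof -
  interpret D: prob_space D by (rule D)
  interpret P: prob_space "Pi\<^sub>M I (\<lambda>_. D)" by (intro prob_space_PiM D)
  interpret pair_sigma_finite "Pi\<^sub>M I (\<lambda>_. D)" D ..
  have restr: "distr (Pi\<^sub>M J (\<lambda>_. D)) (Pi\<^sub>M (insert i I) (\<lambda>_. D)) (\<lambda>\<omega>. restrict \<omega> (insert i I)) =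
      Pi\<^sub>M (insert i I) (\<lambda>_. D)"
    using distr_PiM_reindex[of J "\<lambda>_. D" "\<lambda>x. x" "insert i I"] D I by auto
  have upd: "distr (D \<Otimes>\<^sub>M Pi\<^sub>M I (\<lambda>_. D)) (Pi\<^sub>M (insert i I) (\<lambda>_. D)) (\<lambda>(x, S). S(i := x)) =
      Pi\<^sub>M (insert i I) (\<lambda>_. D)"
    using distr_pair_PiM_eq_PiM[of I "\<lambda>_. D" i] D by auto
  have [measurable]: "(\<lambda>\<omega>. (restrict \<omega> I, \<omega> i)) \<in> Pi\<^sub>M L (\<lambda>_. D) \<rightarrow>\<^sub>M Pi\<^sub>M I (\<lambda>_. D) \<Otimes>\<^sub>M D"
    if "I \<subseteq> L" "i \<in> L" for L
    using that by (intro measurable_Pair measurable_restrict_subset measurable_component_singleton)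
  have [measurable]: "(\<lambda>\<omega>. restrict \<omega> (insert i I)) \<in> Pi\<^sub>M J (\<lambda>_. D) \<rightarrow>\<^sub>M Pi\<^sub>M (insert i I) (\<lambda>_. D)"
    using I by (intro measurable_restrict_subset) auto
  have [measurable]: "(\<lambda>(x, S). S(i := x)) \<in>
      D \<Otimes>\<^sub>M Pi\<^sub>M I (\<lambda>_. D) \<rightarrow>\<^sub>M Pi\<^sub>M (insert i I) (\<lambda>_. D)"
    unfolding split_beta' by (intro measurable_fun_upd[where J = I]) auto
  have "distr (Pi\<^sub>M J (\<lambda>_. D)) (Pi\<^sub>M I (\<lambda>_. D) \<Otimes>\<^sub>M D) (\<lambda>\<omega>. (restrict \<omega> I, \<omega> i)) =
      distr (Pi\<^sub>M (insert i I) (\<lambda>_. D)) (Pi\<^sub>M I (\<lambda>_. D) \<Otimes>\<^sub>M D) (\<lambda>\<omega>. (restrict \<omega> I, \<omega> i))"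
  proof (subst restr[symmetric], subst distr_distr)
    show "(\<lambda>\<omega>. (restrict \<omega> I, \<omega> i)) \<in>
        Pi\<^sub>M (insert i I) (\<lambda>_. D) \<rightarrow>\<^sub>M Pi\<^sub>M I (\<lambda>_. D) \<Otimes>\<^sub>M D" by measurable
  qed (auto simp: comp_def Int_absorb1 subset_insertI intro!: distr_cong)
  also have "\<dots> = distr (D \<Otimes>\<^sub>M Pi\<^sub>M I (\<lambda>_. D)) (Pi\<^sub>M I (\<lambda>_. D) \<Otimes>\<^sub>M D) (\<lambda>(x, S). (S, x))"
  proof (subst upd[symmetric], subst distr_distr)
    show "(\<lambda>\<omega>. (restrict \<omega> I, \<omega> i)) \<in>
        Pi\<^sub>M (insert i I) (\<lambda>_. D) \<rightarrow>\<^sub>M Pi\<^sub>M I (\<lambda>_. D) \<Otimes>\<^sub>M D" by measurable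
  qed (use I(3) in \<open>auto simp: comp_def space_pair_measure space_PiM PiE_def extensional_def
        restrict_def fun_eq_iff intro!: distr_cong\<close>)
  also have "\<dots> = Pi\<^sub>M I (\<lambda>_. D) \<Otimes>\<^sub>M D" by (rule distr_pair_swap[symmetric])
  finally show ?thesis .
qed

section \<open>Measurability of the error region\<close>

definition error_region ::
    "'a set \<Rightarrow> 'a set set \<Rightarrow> 'a set \<Rightarrow> 'a measure \<Rightarrow> nat \<Rightarrow> ((nat \<Rightarrow> 'a) \<times> 'a) set" where
  "error_region X H f D m =
     {(S, x). S \<in> space (Pi\<^sub>M {..<m} (\<lambda>_. D)) \<and> x \<in> space D \<and> x \<in> error_set X H f {..<m} S}"

text \<open>\<open>well_behaved\<close> speaks of the closure of a whole sample, while the learner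
  closes only the positive examples. Their index set takes finitely many values, and these cases are
  treated separately.\<close>

lemma sets_error_region:
  assumes D: "prob_space D" and wb: "well_behaved X H D" and f: "f \<in> H"
  shows "error_region X H f D m \<in> sets (completion (Pi\<^sub>M {..<m} (\<lambda>_. D) \<Otimes>\<^sub>M D))"
proof -
  interpret D: prob_space D by (rule D)
  define P where "P n = Pi\<^sub>M {..<n::nat} (\<lambda>_. D)" for n
  define Q where "Q = P m \<Otimes>\<^sub>M D"
  have P: "prob_space (P n)" for n unfolding P_def by (intro prob_space_PiM D)
  interpret P: prob_space "P m" by (rule P)
  interpret swap: pair_sigma_finite D "P m" ..
  interpret pair_sigma_finite "P m" D ..
  have fD: "f \<in> sets (completion D)" using wb f by (auto simp: well_behaved_def)
  have f_snd: "Measurable.pred (completion Q) (\<lambda>z. snd z \<in> f)"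
  proof -
    have "distr Q D snd = distr (D \<Otimes>\<^sub>M P m) D fst"
      unfolding Q_def by (subst distr_pair_swap, subst distr_distr)
        (auto simp: comp_def split_beta' intro!: distr_cong)
    also have "\<dots> = D" by (rule P.distr_pair_fst)
    finally have "snd -` f \<inter> space Q \<in> sets (completion Q)"
      by (intro vimage_sets_completion[OF _ _ fD]) (auto simp: Q_def)
    then show ?thesis by (simp add: pred_def vimage_def Int_def conj_commute)
  qed
  have f_fst: "Measurable.pred (completion Q) (\<lambda>z. fst z i \<in> f)" if i: "i < m" for i
  proof -
    have [measurable]: "(\<lambda>S. S i) \<in> P m \<rightarrow>\<^sub>M D" "fst \<in> Q \<rightarrow>\<^sub>M P m"
      using i unfolding P_def Q_def by auto
    have "distr Q D (\<lambda>z. fst z i) = distr (distr Q (P m) fst) D (\<lambda>S. S i)"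
      by (subst distr_distr) (auto simp: comp_def)
    also have "distr Q (P m) fst = P m" unfolding Q_def by (rule D.distr_pair_fst)
    also have "distr (P m) D (\<lambda>S. S i) = D"
      using i distr_PiM_component[of "{..<m}" "\<lambda>_. D" i] D unfolding P_def by auto
    finally have "(\<lambda>z. fst z i) -` f \<inter> space Q \<in> sets (completion Q)"
      by (intro vimage_sets_completion[OF _ _ fD]) auto
    then show ?thesis by (simp add: pred_def vimage_def Int_def conj_commute)
  qed
  \<comment> \<open>Enumerating \<open>I\<close> by \<open>e\<close> turns the subsample into a
    sample of size \<open>n\<close>. This reindexing preserves the measure, so the assumption for
    size \<open>n\<close> pulls back along it.\<close>
  have cl: "Measurable.pred (completion Q) (\<lambda>z. snd z \<in> clos X H (fst z ` I))"
    if I: "I \<subseteq> {..<m}" for I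
  proof -
    define n where "n = card I"
    have "finite I" using I by (rule finite_subset) simp
    then obtain e where e: "bij_betw e {..<n} I"
      unfolding n_def using ex_bij_betw_nat_finite[of I] by (auto simp: atLeast0LessThan)
    define T where "T S = (\<lambda>j\<in>{..<n}. S (e j))" for S :: "nat \<Rightarrow> 'a"
    have eI: "inj_on e {..<n}" "e \<in> {..<n} \<rightarrow> {..<m}" "e ` {..<n} = I"
      using e I by (auto simp: bij_betw_def)
    have [measurable]: "T \<in> P m \<rightarrow>\<^sub>M P n"
      using eI(2) unfolding T_def P_def
      by (intro measurable_restrict measurable_component_singleton) auto
    have "distr (P m) (P n) T = P n"
      unfolding T_def P_def using distr_PiM_reindex[of "{..<m}" "\<lambda>_. D" e "{..<n}"] D eI by auto
    moreover have "distr D D (\<lambda>x. x) = D" by (rule distr_id2) simp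
    ultimately have "P n \<Otimes>\<^sub>M D = distr (P m \<Otimes>\<^sub>M D) (P n \<Otimes>\<^sub>M D) (\<lambda>(S, x). (T S, x))"
      using pair_measure_distr[of T "P m" "P n" "\<lambda>x. x" D D] D.sigma_finite_measure_axioms by auto
    then have "(\<lambda>(S, x). (T S, x)) -`
        {(S, x). S \<in> space (P n) \<and> x \<in> space D \<and> x \<in> clos X H (S ` {..<n})} \<inter> space Q
        \<in> sets (completion Q)"
      unfolding Q_def
    proof (intro vimage_sets_completion[where N = "P n \<Otimes>\<^sub>M D"])
      show "(\<lambda>(S, x). (T S, x)) \<in> P m \<Otimes>\<^sub>M D \<rightarrow>\<^sub>M P n \<Otimes>\<^sub>M D" by measurable
    qed (use wb in \<open>auto simp: P_def well_behaved_def\<close>)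
    moreover have "T S \<in> space (P n)" if "S \<in> space (P m)" for S
      by (rule measurable_space[OF _ that]) simp
    moreover have "T S ` {..<n} = S ` I" for S
      unfolding T_def eI(3)[symmetric] by (auto simp: image_image)
    ultimately show ?thesis
      unfolding pred_def
      by (elim back_subst[of "\<lambda>A. A \<in> _"]) (auto simp: Q_def space_pair_measure)
  qed
  \<comment> \<open>The set of positive positions is the only \<open>I\<close> satisfying the
    equivalence, so this finite disjunction evaluates the closure at exactly that set.\<close>
  have "Measurable.pred (completion Q) (\<lambda>z. snd z \<in> f \<and>
      \<not> (\<exists>I\<in>Pow {..<m}. (\<forall>i\<in>{..<m}. fst z i \<in> f \<longleftrightarrow> i \<in> I) \<and> snd z \<in> clos X H (fst z ` I)))"
    by (intro pred_intros_logic pred_intros_finite f_snd f_fst cl) auto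
  then have "{z \<in> space Q. snd z \<in> f \<and>
      \<not> (\<exists>I\<in>Pow {..<m}. (\<forall>i\<in>{..<m}. fst z i \<in> f \<longleftrightarrow> i \<in> I) \<and> snd z \<in> clos X H (fst z ` I))}
      \<in> sets (completion Q)"
    by (simp add: pred_def)
  also have "{z \<in> space Q. snd z \<in> f \<and>
      \<not> (\<exists>I\<in>Pow {..<m}. (\<forall>i\<in>{..<m}. fst z i \<in> f \<longleftrightarrow> i \<in> I) \<and> snd z \<in> clos X H (fst z ` I))} =
      error_region X H f D m"
  proof -
    have "(\<exists>I\<in>Pow {..<m}. (\<forall>i\<in>{..<m}. S i \<in> f \<longleftrightarrow> i \<in> I) \<and> x \<in> clos X H (S ` I)) \<longleftrightarrow>
        x \<in> clos X H (S ` {i\<in>{..<m}. S i \<in> f})" for S x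
    proof
      assume "\<exists>I\<in>Pow {..<m}. (\<forall>i\<in>{..<m}. S i \<in> f \<longleftrightarrow> i \<in> I) \<and> x \<in> clos X H (S ` I)"
      then obtain I where "I \<subseteq> {..<m}" "\<forall>i\<in>{..<m}. S i \<in> f \<longleftrightarrow> i \<in> I" "x \<in> clos X H (S ` I)"
        by auto
      moreover from this have "I = {i\<in>{..<m}. S i \<in> f}" by auto
      ultimately show "x \<in> clos X H (S ` {i\<in>{..<m}. S i \<in> f})" by simp
    qed (auto intro!: bexI[of _ "{i\<in>{..<m}. S i \<in> f}"])
    then show ?thesis
      by (auto simp: error_region_def error_set_def Q_def P_def space_pair_measure)
  qed
  finally show ?thesis by (simp add: Q_def P_def)
qed

section \<open>Moment bound by exchangeability\<close>

text \<open>\<open>U\<close> is a measurable stand-in for the error region; its containment in the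
  region almost everywhere lets hits of \<open>U\<close> count as genuine errors.\<close>

lemma error_moment_bound:
  assumes ic: "intersection_closed X H" and vc: "vc_dim X H = enat d" and fX: "f \<subseteq> X"
    and D: "prob_space D"
    and U: "U \<in> sets (Pi\<^sub>M {..<m} (\<lambda>_. D) \<Otimes>\<^sub>M D)"
    and AE_U: "AE z in Pi\<^sub>M {..<m} (\<lambda>_. D) \<Otimes>\<^sub>M D. z \<in> U \<longrightarrow> z \<in> error_region X H f D m"
  shows "of_nat ((m + k) choose k) * (\<integral>\<^sup>+S. emeasure D (Pair S -` U) ^ k \<partial>Pi\<^sub>M {..<m} (\<lambda>_. D))
    \<le> of_nat ((d + k) choose k)"
proof -
  interpret D: prob_space D by (rule D)
  interpret product_sigma_finite "\<lambda>_::nat. D" ..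
  define n where "n = m + k"
  define Pm where "Pm = Pi\<^sub>M {..<m} (\<lambda>_. D)"
  define P where "P = Pi\<^sub>M {..<n} (\<lambda>_. D)"
  define W where "W = {\<omega> \<in> space P. \<forall>i\<in>{m..<n}. (restrict \<omega> {..<m}, \<omega> i) \<in> U}"
  define \<K> where "\<K> = {K. K \<subseteq> {..<n} \<and> card K = k}"
  interpret P: prob_space P unfolding P_def by (intro prob_space_PiM D)
  have U'[measurable]: "U \<in> sets (Pm \<Otimes>\<^sub>M D)" using U by (simp add: Pm_def)
  have pair_meas[measurable]: "(\<lambda>\<omega>. (restrict \<omega> {..<m}, \<omega> i)) \<in> P \<rightarrow>\<^sub>M Pm \<Otimes>\<^sub>M D" if "i \<in> {m..<n}" for i
    using that unfolding P_def Pm_def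
    by (intro measurable_Pair measurable_restrict_subset measurable_component_singleton)
      (auto simp: n_def)
  have W[measurable]: "W \<in> sets P"
    unfolding W_def using measurable_sets[OF pair_meas U']
    by (intro sets.sets_Collect_finite_All) (auto simp: vimage_def Int_def conj_commute)
  \<comment> \<open>Fubini: given the first \<open>m\<close> points, the last \<open>k\<close> are
    independent, and each hits the section of \<open>U\<close> with probability equal to its
    mass.\<close>
  have emeasure_W: "emeasure P W = (\<integral>\<^sup>+S. emeasure D (Pair S -` U) ^ k \<partial>Pm)"
  proof -
    have n_split: "{..<n} = {..<m} \<union> {m..<n}" by (auto simp: n_def)
    have "emeasure P W = (\<integral>\<^sup>+\<omega>. indicator W \<omega> \<partial>P)" by simp
    also have "\<dots> = (\<integral>\<^sup>+S. (\<integral>\<^sup>+y. indicator W (merge {..<m} {m..<n} (S, y))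
        \<partial>Pi\<^sub>M {m..<n} (\<lambda>_. D)) \<partial>Pm)"
      using W unfolding P_def Pm_def n_split
      by (intro product_nn_integral_fold) (auto intro!: borel_measurable_indicator)
    also have "\<dots> = (\<integral>\<^sup>+S. emeasure D (Pair S -` U) ^ k \<partial>Pm)"
    proof (rule nn_integral_cong)
      fix S assume S: "S \<in> space Pm"
      have sec: "Pair S -` U \<in> sets D" using U' by (rule sets_Pair1)
      have "(\<integral>\<^sup>+y. indicator W (merge {..<m} {m..<n} (S, y)) \<partial>Pi\<^sub>M {m..<n} (\<lambda>_. D)) =
          (\<integral>\<^sup>+y. indicator (Pi\<^sub>E {m..<n} (\<lambda>_. Pair S -` U)) y \<partial>Pi\<^sub>M {m..<n} (\<lambda>_. D))"
      proof (rule nn_integral_cong)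
        fix y assume y: "y \<in> space (Pi\<^sub>M {m..<n} (\<lambda>_. D))"
        have "merge {..<m} {m..<n} (S, y) \<in> space P"
          using S y unfolding P_def Pm_def n_split by (auto simp: space_PiM PiE_def merge_def Pi_iff extensional_def)
        moreover have "restrict (merge {..<m} {m..<n} (S, y)) {..<m} = S"
          using S by (auto simp: Pm_def space_PiM PiE_def extensional_def restrict_def merge_def fun_eq_iff)
        ultimately have "merge {..<m} {m..<n} (S, y) \<in> W \<longleftrightarrow> y \<in> Pi\<^sub>E {m..<n} (\<lambda>_. Pair S -` U)"
          using y by (auto simp: W_def space_PiM PiE_iff merge_def)
        then show "indicator W (merge {..<m} {m..<n} (S, y)) =
            (indicator (Pi\<^sub>E {m..<n} (\<lambda>_. Pair S -` U)) y :: ennreal)"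
          by (simp add: indicator_def)
      qed
      also have "\<dots> = emeasure (Pi\<^sub>M {m..<n} (\<lambda>_. D)) (Pi\<^sub>E {m..<n} (\<lambda>_. Pair S -` U))"
        using sec by (intro nn_integral_indicator sets_PiM_I_finite) auto
      also have "\<dots> = emeasure D (Pair S -` U) ^ k"
        using sec by (subst emeasure_PiM) (auto simp: n_def)
      finally show "(\<integral>\<^sup>+y. indicator W (merge {..<m} {m..<n} (S, y)) \<partial>Pi\<^sub>M {m..<n} (\<lambda>_. D)) =
          emeasure D (Pair S -` U) ^ k" .
    qed
    finally show ?thesis .
  qed
  \<comment> \<open>The exceptional null set of \<open>AE_U\<close> concerns a sample with one extra
    point; it is pulled back once for each of the \<open>k\<close> test positions.\<close>
  have AE_W: "AE \<omega> in P. \<omega> \<in> W \<longrightarrow> \<omega> ` {m..<n} \<subseteq> error_set X H f {..<m} \<omega>"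
  proof -
    have "AE \<omega> in P. (restrict \<omega> {..<m}, \<omega> i) \<in> U \<longrightarrow> \<omega> i \<in> error_set X H f {..<m} \<omega>"
      if i: "i \<in> {m..<n}" for i
    proof -
      have pres: "distr P (Pm \<Otimes>\<^sub>M D) (\<lambda>\<omega>. (restrict \<omega> {..<m}, \<omega> i)) = Pm \<Otimes>\<^sub>M D"
        using i unfolding P_def Pm_def by (intro distr_PiM_restrict_pair D) (auto simp: n_def)
      have "AE z in distr P (Pm \<Otimes>\<^sub>M D) (\<lambda>\<omega>. (restrict \<omega> {..<m}, \<omega> i)).
          z \<in> U \<longrightarrow> z \<in> error_region X H f D m"
        unfolding pres using AE_U by (simp only: Pm_def)
      from AE_distrD[OF pair_meas[OF i] this] show ?thesis
      proof eventually_elim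
        case (elim \<omega>)
        have "{j. j < m \<and> restrict \<omega> {..<m} j \<in> f} = {j. j < m \<and> \<omega> j \<in> f}" by auto
        moreover have "restrict \<omega> {..<m} ` {j. j < m \<and> \<omega> j \<in> f} = \<omega> ` {j. j < m \<and> \<omega> j \<in> f}"
          by (auto simp: image_iff)
        ultimately show ?case using elim by (auto simp: error_region_def error_set_def)
      qed
    qed
    then have "AE \<omega> in P. \<forall>i\<in>{m..<n}. (restrict \<omega> {..<m}, \<omega> i) \<in> U \<longrightarrow>
        \<omega> i \<in> error_set X H f {..<m} \<omega>"
      by (intro AE_finite_allI) auto
    then show ?thesis by eventually_elim (auto simp: W_def)
  qed
  \<comment> \<open>Permuting the sample by this bijection turns the fixed split after position
    \<open>m\<close> into the split with hold-out set \<open>K\<close>.\<close>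
  have "\<exists>\<sigma>. bij_betw \<sigma> {..<n} {..<n} \<and> \<sigma> ` {..<m} = {..<n} - K \<and> \<sigma> ` {m..<n} = K"
    if K: "K \<in> \<K>" for K
  proof -
    have fin: "finite K" using K by (auto simp: \<K>_def intro: finite_subset)
    have "card ({..<n} - K) = m" using K fin by (auto simp: \<K>_def n_def card_Diff_subset)
    then obtain \<sigma>1 where 1: "bij_betw \<sigma>1 {..<m} ({..<n} - K)"
      using finite_same_card_bij[of "{..<m}" "{..<n} - K"] by auto
    have "card K = card {m..<n}" using K by (simp add: \<K>_def n_def)
    then obtain \<sigma>2 where 2: "bij_betw \<sigma>2 {m..<n} K"
      using finite_same_card_bij[of "{m..<n}" K] fin by auto
    define \<sigma> where "\<sigma> i = (if i < m then \<sigma>1 i else \<sigma>2 i)" for i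
    have \<sigma>1: "bij_betw \<sigma> {..<m} ({..<n} - K)"
      using 1 by (subst bij_betw_cong[of _ _ \<sigma>1]) (auto simp: \<sigma>_def)
    have \<sigma>2: "bij_betw \<sigma> {m..<n} K"
      using 2 by (subst bij_betw_cong[of _ _ \<sigma>2]) (auto simp: \<sigma>_def)
    from bij_betw_combine[OF \<sigma>1 \<sigma>2] have "bij_betw \<sigma> ({..<m} \<union> {m..<n}) ({..<n} - K \<union> K)"
      by auto
    moreover have "{..<m} \<union> {m..<n} = {..<n}" "{..<n} - K \<union> K = {..<n}"
      using K by (auto simp: \<K>_def n_def)
    ultimately show ?thesis using \<sigma>1 \<sigma>2 by (metis bij_betw_imp_surj_on)
  qed
  then obtain \<sigma> where \<sigma>: "\<And>K. K \<in> \<K> \<Longrightarrow> bij_betw (\<sigma> K) {..<n} {..<n}"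
    "\<And>K. K \<in> \<K> \<Longrightarrow> \<sigma> K ` {..<m} = {..<n} - K" "\<And>K. K \<in> \<K> \<Longrightarrow> \<sigma> K ` {m..<n} = K" by metis
  define T where "T K \<omega> = (\<lambda>i\<in>{..<n}. \<omega> (\<sigma> K i))" for K and \<omega> :: "nat \<Rightarrow> 'a"
  have T_meas[measurable]: "T K \<in> P \<rightarrow>\<^sub>M P" if "K \<in> \<K>" for K
    using bij_betwE[OF \<sigma>(1)[OF that]] unfolding T_def P_def
    by (intro measurable_restrict measurable_component_singleton) auto
  have T_distr: "distr P P (T K) = P" if "K \<in> \<K>" for K
    using distr_PiM_reindex[of "{..<n}" "\<lambda>_. D" "\<sigma> K" "{..<n}"] D \<sigma>(1)[OF that]
    unfolding T_def P_def by (auto simp: bij_betw_def)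
  have "AE \<omega> in P. T K \<omega> \<in> W \<longrightarrow> \<omega> ` K \<subseteq> error_set X H f ({..<n} - K) \<omega>" if K: "K \<in> \<K>" for K
  proof -
    have "AE \<omega> in distr P P (T K). \<omega> \<in> W \<longrightarrow> \<omega> ` {m..<n} \<subseteq> error_set X H f {..<m} \<omega>"
      unfolding T_distr[OF K] by (rule AE_W)
    from AE_distrD[OF T_meas[OF K] this] show ?thesis
    proof eventually_elim
      case (elim \<omega>)
      have "T K \<omega> ` {m..<n} = \<omega> ` \<sigma> K ` {m..<n}"
        by (auto simp: T_def image_image intro!: image_cong)
      moreover have "T K \<omega> ` {i\<in>{..<m}. T K \<omega> i \<in> f} = \<omega> ` {i\<in>\<sigma> K ` {..<m}. \<omega> i \<in> f}"
        by (auto simp: T_def n_def image_iff)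
      ultimately show ?case using elim \<sigma>[OF K] by (simp add: error_set_def)
    qed
  qed
  then have AE_all: "AE \<omega> in P. \<forall>K\<in>\<K>. T K \<omega> \<in> W \<longrightarrow> \<omega> ` K \<subseteq> error_set X H f ({..<n} - K) \<omega>"
    by (intro AE_finite_allI) (auto simp: \<K>_def)
  have finK: "finite \<K>" by (auto simp: \<K>_def)
  \<comment> \<open>Every \<open>T K\<close> preserves \<open>P\<close>, so all summands equal the
    probability of \<open>W\<close>. The sum is also the expected number of \<open>K\<close> with
    \<open>T K \<omega>\<close> in \<open>W\<close>.\<close>
  have "of_nat (n choose k) * emeasure P W = (\<Sum>K\<in>\<K>. emeasure (distr P P (T K)) W)"
    using T_distr by (simp add: \<K>_def n_subsets)
  also have "\<dots> = (\<Sum>K\<in>\<K>. \<integral>\<^sup>+\<omega>. indicator W (T K \<omega>) \<partial>P)"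
  proof (intro sum.cong refl)
    fix K assume K: "K \<in> \<K>"
    have "emeasure (distr P P (T K)) W = (\<integral>\<^sup>+\<omega>. indicator W \<omega> \<partial>distr P P (T K))"
      using W by simp
    also have "\<dots> = (\<integral>\<^sup>+\<omega>. indicator W (T K \<omega>) \<partial>P)"
      using W K by (intro nn_integral_distr T_meas) (auto intro!: borel_measurable_indicator)
    finally show "emeasure (distr P P (T K)) W = (\<integral>\<^sup>+\<omega>. indicator W (T K \<omega>) \<partial>P)" .
  qed
  also have "\<dots> = (\<integral>\<^sup>+\<omega>. (\<Sum>K\<in>\<K>. indicator W (T K \<omega>)) \<partial>P)"
    by (intro nn_integral_sum[symmetric]) measurable
  also have "\<dots> \<le> (\<integral>\<^sup>+\<omega>. of_nat ((d + k) choose k) \<partial>P)"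
  proof (rule nn_integral_mono_AE)
    show "AE \<omega> in P. (\<Sum>K\<in>\<K>. indicator W (T K \<omega>)) \<le> (of_nat ((d + k) choose k) :: ennreal)"
      using AE_all
    proof eventually_elim
      case (elim \<omega>)
      have "(\<Sum>K\<in>\<K>. indicator W (T K \<omega>)) = (of_nat (card {K\<in>\<K>. T K \<omega> \<in> W}) :: ennreal)"
        using finK by (simp add: indicator_def sum.If_cases Int_def)
      \<comment> \<open>For almost every sample each counted \<open>K\<close> is missed entirely by
        the closure of the other positive examples, so the combinatorial bound applies
        pointwise.\<close>
      also have "card {K\<in>\<K>. T K \<omega> \<in> W} \<le>
          card {K. K \<subseteq> {..<n} \<and> card K = k \<and> \<omega> ` K \<subseteq> error_set X H f ({..<n} - K) \<omega>}"
        using elim by (intro card_mono) (auto simp: \<K>_def)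
      also have "\<dots> \<le> (d + k) choose k" by (rule card_holdout_error_le[OF ic vc fX]) simp
      finally show ?case by simp
    qed
  qed
  also have "\<dots> = of_nat ((d + k) choose k)" by (simp add: P.emeasure_space_1)
  finally show ?thesis unfolding emeasure_W n_def Pm_def .
qed

section \<open>Binomial estimates\<close>

text \<open>The right-hand side is the product of \<open>m + 1\<close>, ...,
  \<open>m + k\<close>.\<close>

lemma power_le_binomial_mult_fact: "m ^ k \<le> ((m + k) choose k) * fact k"
proof (induction k)
  case (Suc k)
  have "m ^ Suc k \<le> (m + Suc k) * (((m + k) choose k) * fact k)"
    unfolding power_Suc using Suc.IH by (intro mult_mono) auto
  also have "\<dots> = (Suc k * ((m + Suc k) choose Suc k)) * fact k"
    using Suc_times_binomial_eq[of "m + k" k] by (simp add: algebra_simps)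
  finally show ?case by (simp add: algebra_simps)
qed simp

text \<open>After multiplication by \<open>fact k\<close> the numerator is at most
  \<open>(d + k) ^ k\<close> and the denominator at least \<open>m ^ k\<close>.\<close>

lemma binomial_ratio_le:
  assumes "m > 0"
  shows "real ((d + k) choose k) / real ((m + k) choose k) \<le> (real (d + k) / real m) ^ k"
proof -
  have "(m ^ k * ((d + k) choose k)) * fact k \<le>
      (((m + k) choose k) * fact k) * (((d + k) choose k) * fact k)"
    using mult_right_mono[OF power_le_binomial_mult_fact[of m k], of "((d + k) choose k) * fact k"]
    by (simp add: mult.assoc)
  also have "\<dots> \<le> (((m + k) choose k) * fact k) * (d + k) ^ k"
    using binomial_fact_pow by (intro mult_left_mono) auto
  finally have "m ^ k * ((d + k) choose k) \<le> ((m + k) choose k) * (d + k) ^ k"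
    by (simp add: algebra_simps)
  then have "real m ^ k * real ((d + k) choose k) \<le> real ((m + k) choose k) * real (d + k) ^ k"
    by (metis of_nat_le_iff of_nat_mult of_nat_power)
  moreover have "real ((m + k) choose k) > 0" by simp
  ultimately show ?thesis
    using assms by (simp add: power_divide divide_le_eq le_divide_eq mult.commute)
qed

section \<open>The closure learner and its loss\<close>

text \<open>Without false positives, an agent that moves into \<open>h\<close> or is already there
  is classified correctly. One that stays outside \<open>h\<close> can be misclassified only by
  lying in \<open>f\<close>.\<close>

lemma improvement_loss_one_subset:
  assumes "h \<subseteq> f" "improvement_loss \<Delta> h f x = 1"
  shows "x \<in> f - h"
proof (rule ccontr)
  assume "x \<notin> f - h"
  then have "(\<lambda>x'. of_bool ((x' \<in> h) \<noteq> (x' \<in> f)) :: nat) ` reaction_set \<Delta> h x = {0}"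
    using assms(1) by (auto simp: reaction_set_def image_iff) blast
  then show False using assms(2) by (simp add: improvement_loss_def)
qed

definition closure_learner :: "'a set \<Rightarrow> 'a set set \<Rightarrow> ('a \<times> bool) list \<Rightarrow> 'a set" where
  "closure_learner X H l = clos X H {x. (x, True) \<in> set l}"

lemma closure_learner_labeled_sample:
  "closure_learner X H (labeled_sample f m S) = clos X H (S ` {i\<in>{..<m}. S i \<in> f})"
proof -
  have "{x. (x, True) \<in> set (labeled_sample f m S)} = S ` {i\<in>{..<m}. S i \<in> f}"
    by (auto simp: labeled_sample_def)
  then show ?thesis by (simp only: closure_learner_def)
qed

text \<open>For arbitrary \<open>\<Delta>\<close> the loss set may fail to be measurable, so it is
  covered by a measurable \<open>A\<close> and bounded by monotonicity of the outer measure.\<close>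

lemma closure_learner_loss_le:
  assumes "f \<in> H" "error_set X H f {..<m} S \<inter> space D \<subseteq> A" "A \<in> sets D"
  shows "expected_improvement_loss \<Delta> D (closure_learner X H (labeled_sample f m S)) f \<le> emeasure D A"
proof -
  define h where "h = closure_learner X H (labeled_sample f m S)"
  have h: "h \<subseteq> f" "error_set X H f {..<m} S = f - h"
    unfolding h_def closure_learner_labeled_sample error_set_def
    using assms(1) by (intro clos_subset) auto
  have "{x \<in> space D. improvement_loss \<Delta> h f x = 1} \<subseteq> A"
    using improvement_loss_one_subset[OF h(1)] assms(2) unfolding h(2) by auto
  from outer_measure_of_mono[OF this, of D] show ?thesis
    using assms(3) by (simp add: expected_improvement_loss_def h_def)
qed

text \<open>A point of \<open>f\<close> outside \<open>clos X H {}\<close> would form a singleton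
  shattered by that closure and \<open>f\<close>. This settles the case in which the learner sees no
  examples.\<close>

lemma error_set_vc_dim_0:
  assumes ic: "intersection_closed X H" and vc: "vc_dim X H = enat 0" and f: "f \<in> H" "f \<subseteq> X"
  shows "error_set X H f {} S = {}"
proof -
  have "x \<in> clos X H {}" if x: "x \<in> f" for x
  proof (rule ccontr)
    assume "x \<notin> clos X H {}"
    moreover have "clos X H {} \<in> H" by (intro clos_in[OF ic]) auto
    ultimately have "\<exists>h\<in>H. h \<inter> {x} = {}" "\<exists>h\<in>H. h \<inter> {x} = {x}"
      using x f(1) by auto
    then have "shatters H {x}" by (auto simp: shatters_def subset_singleton_iff)
    with x f(2) have "card {x} \<le> 0" by (intro card_le_vc_dim[OF vc]) auto
    then show False by simp
  qed
  then show ?thesis by (auto simp: error_set_def)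
qed

section \<open>Tail bound and sample size\<close>

text \<open>Markov's inequality for the \<open>k\<close>-th power of \<open>v\<close>, which is at
  least \<open>\<epsilon> ^ k\<close> wherever \<open>v\<close> exceeds
  \<open>\<epsilon>\<close>.\<close>

lemma prob_moment_bound:
  assumes "prob_space P" and v[measurable]: "v \<in> borel_measurable P" and nonneg: "\<And>S. v S \<ge> 0"
    and bound: "(\<integral>\<^sup>+S. ennreal (v S) ^ k \<partial>P) \<le> ennreal r" and r: "r \<ge> 0" and \<epsilon>: "\<epsilon> > 0"
  shows "measure P {S \<in> space P. v S \<le> \<epsilon>} \<ge> 1 - r / \<epsilon> ^ k"
proof -
  interpret prob_space P by fact
  have "emeasure P {S \<in> space P. 1 \<le> ennreal (1 / \<epsilon> ^ k) * ennreal (v S) ^ k} \<le>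
      ennreal (1 / \<epsilon> ^ k) * (\<integral>\<^sup>+S. ennreal (v S) ^ k * indicator (space P) S \<partial>P)"
    by (intro nn_integral_Markov_inequality) measurable
  also have "(\<integral>\<^sup>+S. ennreal (v S) ^ k * indicator (space P) S \<partial>P) = (\<integral>\<^sup>+S. ennreal (v S) ^ k \<partial>P)"
    by (intro nn_integral_cong) simp
  also have "ennreal (1 / \<epsilon> ^ k) * \<dots> \<le> ennreal (1 / \<epsilon> ^ k) * ennreal r"
    by (intro mult_left_mono bound) simp
  also have "\<dots> = ennreal (r / \<epsilon> ^ k)"
    using \<epsilon> r by (simp add: ennreal_mult[symmetric])
  finally have tail: "prob {S \<in> space P. 1 \<le> ennreal (1 / \<epsilon> ^ k) * ennreal (v S) ^ k} \<le> r / \<epsilon> ^ k"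
    using r \<epsilon> by (simp add: emeasure_eq_measure)
  have "1 \<le> ennreal (1 / \<epsilon> ^ k) * ennreal (v S) ^ k" if "\<not> v S \<le> \<epsilon>" for S
  proof -
    have "\<epsilon> ^ k \<le> v S ^ k" using that \<epsilon> by (intro power_mono) auto
    then have "1 \<le> 1 / \<epsilon> ^ k * v S ^ k" using \<epsilon> by simp
    then have "1 \<le> ennreal (1 / \<epsilon> ^ k * v S ^ k)" by simp
    also have "\<dots> = ennreal (1 / \<epsilon> ^ k) * ennreal (v S) ^ k"
      using \<epsilon> nonneg by (subst ennreal_mult) (auto simp: ennreal_power)
    finally show ?thesis by simp
  qed
  then have "prob (space P - {S \<in> space P. v S \<le> \<epsilon>}) \<le>
      prob {S \<in> space P. 1 \<le> ennreal (1 / \<epsilon> ^ k) * ennreal (v S) ^ k}"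
    by (intro finite_measure_mono) auto
  with tail show ?thesis by (subst (asm) prob_compl) auto
qed

text \<open>The factor 3 is an upper bound for \<open>exp 1\<close>: it makes
  \<open>(d + k) / (\<epsilon> * m)\<close> at most \<open>1 / exp 1\<close>, so the failure
  probability is at most \<open>exp (- k)\<close>.\<close>

lemma closure_learner_succeeds:
  assumes ic: "intersection_closed X H" and vc: "vc_dim X H = enat d" and HX: "H \<subseteq> Pow X"
    and D: "prob_space D" and wb: "well_behaved X H D" and f: "f \<in> H"
    and \<epsilon>: "\<epsilon> > 0" and \<delta>: "exp (- real k) \<le> \<delta>"
    and m: "m > 0" "3 * real (d + k) \<le> \<epsilon> * real m"
  shows "\<exists>G\<in>sets (Pi\<^sub>M {..<m} (\<lambda>_. D)). measure (Pi\<^sub>M {..<m} (\<lambda>_. D)) G \<ge> 1 - \<delta> \<and>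
    (\<forall>S\<in>G. expected_improvement_loss \<Delta> D (closure_learner X H (labeled_sample f m S)) f
      \<le> ennreal \<epsilon>)"
proof -
  interpret D: prob_space D by (rule D)
  define P where "P = Pi\<^sub>M {..<m} (\<lambda>_. D)"
  have P: "prob_space P" unfolding P_def by (intro prob_space_PiM D)
  obtain U where U: "U \<in> sets (P \<Otimes>\<^sub>M D)" "error_region X H f D m \<subseteq> U"
    and AE_U: "AE z in P \<Otimes>\<^sub>M D. z \<in> U \<longrightarrow> z \<in> error_region X H f D m"
    using completion_AE_superset[OF sets_error_region[OF D wb f]] unfolding P_def by blast
  \<comment> \<open>The mass of the section of \<open>U\<close> dominates that of the error set and
    depends measurably on the sample, so \<open>v S \<le> \<epsilon>\<close> can serve as the good
    event.\<close>
  define v where "v S = measure D (Pair S -` U)" for S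
  have v_emeasure: "emeasure D (Pair S -` U) = ennreal (v S)" for S
    by (simp add: v_def D.emeasure_eq_measure)
  have v_meas: "v \<in> borel_measurable P"
    unfolding v_def measure_def using D.measurable_emeasure_Pair[OF U(1)] by measurable
  define r where "r = real ((d + k) choose k) / real ((m + k) choose k)"
  have pos: "real ((m + k) choose k) > 0" by simp
  have "ennreal (real ((m + k) choose k)) * (\<integral>\<^sup>+S. ennreal (v S) ^ k \<partial>P) \<le>
      ennreal (real ((d + k) choose k))"
    using error_moment_bound[OF ic vc _ D U(1)[unfolded P_def] AE_U[unfolded P_def], of k] HX f
    by (auto simp: v_emeasure P_def ennreal_of_nat_eq_real_of_nat)
  also have "\<dots> = ennreal (real ((m + k) choose k)) * ennreal r"
    using pos by (simp add: r_def ennreal_mult[symmetric])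
  finally have moment: "(\<integral>\<^sup>+S. ennreal (v S) ^ k \<partial>P) \<le> ennreal r"
    using pos by (subst (asm) ennreal_mult_le_mult_iff) auto
  have "r / \<epsilon> ^ k \<le> (real (d + k) / real m) ^ k / \<epsilon> ^ k"
    using binomial_ratio_le[OF m(1)] \<epsilon> unfolding r_def by (intro divide_right_mono) auto
  also have "\<dots> = (real (d + k) / (\<epsilon> * real m)) ^ k"
    by (simp add: power_divide power_mult_distrib mult.commute)
  also have "\<dots> \<le> (1 / exp 1) ^ k"
  proof (rule power_mono)
    have "real (d + k) * exp 1 \<le> real (d + k) * 3" by (intro mult_left_mono exp_le) simp
    also have "\<dots> \<le> \<epsilon> * real m" using m(2) by simp
    finally show "real (d + k) / (\<epsilon> * real m) \<le> 1 / exp 1"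
      using \<epsilon> m(1) by (simp add: field_simps)
  qed (use \<epsilon> in simp)
  also have "\<dots> = exp (- real k)"
    by (simp add: exp_minus power_one_over exp_of_nat_mult[symmetric] inverse_eq_divide)
  also note \<delta>
  finally have "1 - \<delta> \<le> 1 - r / \<epsilon> ^ k" by simp
  also have "\<dots> \<le> measure P {S \<in> space P. v S \<le> \<epsilon>}"
  proof (rule prob_moment_bound[OF P v_meas _ moment _ \<epsilon>])
    show "v S \<ge> 0" "r \<ge> 0" for S by (simp_all add: v_def r_def)
  qed
  finally have prob: "measure P {S \<in> space P. v S \<le> \<epsilon>} \<ge> 1 - \<delta>" .
  have "expected_improvement_loss \<Delta> D (closure_learner X H (labeled_sample f m S)) f \<le> ennreal \<epsilon>"
    if S: "S \<in> space P" "v S \<le> \<epsilon>" for S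
  proof -
    have "emeasure D (Pair S -` U) \<le> ennreal \<epsilon>"
      using S(2) by (simp add: v_emeasure ennreal_leI)
    moreover have "error_set X H f {..<m} S \<inter> space D \<subseteq> Pair S -` U"
      using U(2) S(1) by (auto simp: error_region_def P_def)
    ultimately show ?thesis
      using closure_learner_loss_le[OF f _ sets_Pair1[OF U(1)]] by (meson order_trans)
  qed
  then show ?thesis
    using prob v_meas unfolding P_def[symmetric]
    by (intro bexI[of _ "{S \<in> space P. v S \<le> \<epsilon>}"]) (auto intro!: borel_measurable_le)
qed

theorem theorem4p7:
  shows "\<exists>C::real. C > 0 \<and>
    (\<forall>(X::'a set) (H::'a set set) (d::nat).
       H \<subseteq> Pow X \<longrightarrow> intersection_closed X H \<longrightarrow> vc_dim X H = enat d \<longrightarrow>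
       (\<exists>(learner :: ('a \<times> bool) list \<Rightarrow> 'a set) (M :: real \<Rightarrow> real \<Rightarrow> nat).
          (\<forall>\<epsilon>\<in>{0<..<1}. \<forall>\<delta>\<in>{0<..<1}.
             real (M \<epsilon> \<delta>) \<le> C * (1 / \<epsilon> * (real d + ln (1 / \<delta>)))) \<and>
          (\<forall>(\<Delta> :: 'a \<Rightarrow> 'a set) (D :: 'a measure).
             \<Delta> \<in> X \<rightarrow> Pow X \<longrightarrow> prob_space D \<longrightarrow> space D = X \<longrightarrow> well_behaved X H D \<longrightarrow>
             PAC_learns_with_improvements H \<Delta> D M learner)))"
proof (intro exI[of _ 7] conjI allI impI)
  fix X :: "'a set" and H :: "'a set set" and d :: nat
  assume HX: "H \<subseteq> Pow X" and ic: "intersection_closed X H" and vc: "vc_dim X H = enat d"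
  \<comment> \<open>For \<open>d = 0\<close> and \<open>\<delta>\<close> near 1 the allowed sample size drops below 1, so no example can be used.\<close>
  define k where "k \<delta> = nat \<lceil>ln (1 / \<delta>)\<rceil>" for \<delta> :: real
  define M where "M \<epsilon> \<delta> = (if d = 0 then 0 else nat \<lceil>3 * real (d + k \<delta>) / \<epsilon>\<rceil>)" for \<epsilon> \<delta> :: real
  have size: "real (M \<epsilon> \<delta>) \<le> 7 * (1 / \<epsilon> * (real d + ln (1 / \<delta>)))"
    if "\<epsilon> \<in> {0<..<1}" "\<delta> \<in> {0<..<1}" for \<epsilon> \<delta>
  proof -
    have \<epsilon>: "0 < \<epsilon>" "\<epsilon> < 1" and ln: "ln (1 / \<delta>) > 0" using that by auto
    show ?thesis
    proof (cases "d = 0")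
      case False
      have "real (M \<epsilon> \<delta>) \<le> 3 * real (d + k \<delta>) / \<epsilon> + 1"
        using False \<epsilon> by (simp add: M_def)
      also have "\<dots> \<le> 3 * (real d + (ln (1 / \<delta>) + 1)) / \<epsilon> + 1 / \<epsilon>"
      proof -
        have "real (k \<delta>) \<le> ln (1 / \<delta>) + 1" using ln unfolding k_def by linarith
        then show ?thesis using \<epsilon> by (intro add_mono divide_right_mono) auto
      qed
      also have "\<dots> = 1 / \<epsilon> * (3 * real d + 3 * ln (1 / \<delta>) + 4)"
        by (simp add: algebra_simps add_divide_distrib)
      \<comment> \<open>The 4 collects the costs of the two ceilings: 3 from \<open>k\<close>, and 1
        from \<open>M\<close>, where the loss of 1 was raised to \<open>1 / \<epsilon>\<close>. As
        \<open>d\<close> is at least 1, it is at most \<open>4 * d\<close>, whence the constant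
        7.\<close>
      also have "\<dots> \<le> 1 / \<epsilon> * (7 * (real d + ln (1 / \<delta>)))"
        using False \<epsilon> ln by (intro mult_left_mono) auto
      finally show ?thesis by simp
    qed (use \<epsilon> ln in \<open>simp add: M_def\<close>)
  qed
  have learns: "PAC_learns_with_improvements H \<Delta> D M (closure_learner X H)"
    if D: "prob_space D" "space D = X" and wb: "well_behaved X H D" for \<Delta> and D :: "'a measure"
    unfolding PAC_learns_with_improvements_def
  proof (intro ballI)
    fix f and \<epsilon> \<delta> :: real
    assume f: "f \<in> H" and \<epsilon>: "\<epsilon> \<in> {0<..<1}" and \<delta>: "\<delta> \<in> {0<..<1}"
    show "\<exists>G\<in>sets (Pi\<^sub>M {..<M \<epsilon> \<delta>} (\<lambda>_. D)). 1 - \<delta> \<le> measure (Pi\<^sub>M {..<M \<epsilon> \<delta>} (\<lambda>_. D)) G \<and>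
        (\<forall>S\<in>G. expected_improvement_loss \<Delta> D (closure_learner X H (labeled_sample f (M \<epsilon> \<delta>) S)) f
          \<le> ennreal \<epsilon>)"
    proof (cases "d = 0")
      \<comment> \<open>The sample is empty and so is the error set, whatever \<open>S\<close> is;
        the good event is the whole space.\<close>
      case True
      interpret P: prob_space "Pi\<^sub>M {..<M \<epsilon> \<delta>} (\<lambda>_. D)" by (intro prob_space_PiM D)
      have "expected_improvement_loss \<Delta> D (closure_learner X H (labeled_sample f (M \<epsilon> \<delta>) S)) f \<le>
          emeasure D {}" for S
      proof (rule closure_learner_loss_le[OF f])
        show "error_set X H f {..<M \<epsilon> \<delta>} S \<inter> space D \<subseteq> {}"
          using error_set_vc_dim_0[OF ic _ f] vc True HX f
          by (auto simp: M_def)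
      qed simp
      then show ?thesis
        using \<delta> P.prob_space by (intro bexI[OF _ sets.top]) auto
    next
      case False
      have "3 * real (d + k \<delta>) / \<epsilon> \<le> real (M \<epsilon> \<delta>)"
        using False by (simp add: M_def) linarith
      moreover from this have "0 < M \<epsilon> \<delta>"
        using False \<epsilon> by (intro gr0I) (auto simp: divide_le_0_iff)
      moreover have "exp (- real (k \<delta>)) \<le> \<delta>"
      proof -
        have "ln (1 / \<delta>) \<le> real (k \<delta>)" unfolding k_def by linarith
        then have "- real (k \<delta>) \<le> ln \<delta>" using \<delta> by (simp add: ln_div)
        then show ?thesis using \<delta> by (simp add: ln_ge_iff)
      qed
      ultimately show ?thesis
        using \<epsilon> by (intro closure_learner_succeeds[OF ic vc HX D(1) wb f, where k = "k \<delta>"])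
          (auto simp: field_simps)
    qed
  qed
  show "\<exists>learner M. (\<forall>\<epsilon>\<in>{0<..<1}. \<forall>\<delta>\<in>{0<..<1}.
        real (M \<epsilon> \<delta>) \<le> 7 * (1 / \<epsilon> * (real d + ln (1 / \<delta>)))) \<and>
      (\<forall>\<Delta> D. \<Delta> \<in> X \<rightarrow> Pow X \<longrightarrow> prob_space D \<longrightarrow> space D = X \<longrightarrow> well_behaved X H D \<longrightarrow>
        PAC_learns_with_improvements H \<Delta> D M learner)"
    using size learns by (intro exI[of _ "closure_learner X H"] exI[of _ M]) blast
qed simp

end
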